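(* Let $p\ge 1$ and consider the $p$ hypergeometric weights, the moment matrix $\mathscr M$, its Gauss--Borel factorization $\mathscr M=S^{-1}H\tilde S^{-\top}$ and the operator $\vartheta$ described in the context. Put $q_n:=\log H_n$, $f^{(m)}_n:=S^{[m]}_n$ and $f^{(-m)}_n:=S^{[-m]}_n$ for $m\in\{1,\dots,p\}$, with $f^{(0)}_n:=1$ and $f^{(m)}_{-1}:=0$ for $m\ge1$. Then these functions solve the following system: $$\vartheta q_n=f^{(1)}_{n-1}-f^{(1)}_n,$$ $$f^{(m+1)}_{n-1}+f^{(-m-1)}_n+\sum_{j=1}^{m}f^{(m-j)}_{n+j}f^{(-j)}_n=-\Big[\vartheta f^{(m)}_n+\sum_{j=1}^{m-1}\big(\vartheta f^{(m-j)}_{n+j}\big)f^{(-j)}_n\Big],\qquad m\in\{1,\dots,p-1\},$$ $$e^{q_{n+p}-q_n}=-\Big[\vartheta f^{(p)}_n+\sum_{j=1}^{p-1}\big(\vartheta f^{(p-j)}_{n+j}\big)f^{(-j)}_n\Big].$$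
   Context: All semi-infinite matrices are indexed from $0$. $\Lambda$ is the shift matrix with $\Lambda_{n,n+1}=1$ and all other entries zero. Weights: $w^{(a)}(k)=\frac{(b_1^{(a)})_k\cdots(b_{M^{(a)}}^{(a)})_k}{(c_1)_k\cdots(c_N)_k}\frac{(\eta^{(a)})^k}{k!}$, $k\in\mathbb N_0$, $a\in\{1,\dots,p\}$, where $(x)_k$ is the Pochhammer symbol and $\eta^{(1)},\dots,\eta^{(p)}$ are independent variables. All parameters are such that the weights are well defined and all moments converge. Moments: $\rho^{(a)}_m=\sum_{k\ge0}k^mw^{(a)}(k)$. Moment matrix: $\mathscr M_{n,pl+a-1}=\rho^{(a)}_{n+l}$ for $n,l\in\mathbb N_0$, $a\in\{1,\dots,p\}$. Operators: $\vartheta^{(a)}=\eta^{(a)}\frac{\partial}{\partial\eta^{(a)}}$, $\vartheta=\sum_{a=1}^p\vartheta^{(a)}$, acting entrywise. It is assumed that the Gauss--Borel factorization $\mathscr M=S^{-1}H\tilde S^{-\top}$ exists, with $S,\tilde S$ lower unitriangular and $H=\operatorname{diag}(H_0,H_1,\dots)$ invertible. Write $S=I+\sum_{m\ge1}(\Lambda^\top)^mS^{[m]}$ and $S^{-1}=I+\sum_{m\ge1}(\Lambda^\top)^mS^{[-m]}$ with diagonal matrices $S^{[\pm m]}=\operatorname{diag}(S^{[\pm m]}_0,S^{[\pm m]}_1,\dots)$; thus $S^{[m]}_n=S_{n+m,n}$ and $S^{[-m]}_n=(S^{-1})_{n+m,n}$. $\log H_n$ denotes any local branch.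
   Formalization: In the second equation the sum on the left is corrected to $\sum_{j=1}^{m}f^{(m-j+1)}_{n+j-1}f^{(-j)}_n$; as printed it fails, e.g. for $p=2$, $w^{(a)}(k)=(\eta^{(a)})^k/k!$ with distinct positive $\eta^{(a)}$, $m=1$, $n=0$. *)

theory Defs
  imports "HOL-Analysis.Analysis"
begin

section \<open>Weights, moments and the moment matrix\<close>

text \<open>
  A point \<open>\<eta> = (\<eta> 1, \<dots>, \<eta> p)\<close> of complex p-space is an extensional function on \<open>{1..p}\<close>. The upper
  parameters of the a-th weight are the list \<open>b a\<close> (so its length depends on \<open>a\<close>); the lower
  parameters \<open>c\<close> are common to all the weights. Either list may be empty.
\<close>

abbreviation eta_space :: "nat \<Rightarrow> (nat \<Rightarrow> complex) topology" where
  "eta_space p \<equiv> product_topology (\<lambda>_. euclidean) {1..p}"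

definition weight ::
  "(nat \<Rightarrow> complex list) \<Rightarrow> complex list \<Rightarrow> (nat \<Rightarrow> complex) \<Rightarrow> nat \<Rightarrow> nat \<Rightarrow> complex" where
  "weight b c \<eta> a k =
     (\<Prod>x\<leftarrow>b a. pochhammer x k) / (\<Prod>x\<leftarrow>c. pochhammer x k) * (\<eta> a ^ k / fact k)"

definition moment ::
  "(nat \<Rightarrow> complex list) \<Rightarrow> complex list \<Rightarrow> (nat \<Rightarrow> complex) \<Rightarrow> nat \<Rightarrow> nat \<Rightarrow> complex" where
  "moment b c \<eta> a m = (\<Sum>k. of_nat k ^ m * weight b c \<eta> a k)"

text \<open>Column \<open>p * l + a - 1\<close> with \<open>a \<in> {1..p}\<close> has quotient \<open>l\<close> and remainder \<open>a - 1\<close> modulo \<open>p\<close>.\<close>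

definition moment_matrix ::
  "nat \<Rightarrow> (nat \<Rightarrow> complex list) \<Rightarrow> complex list \<Rightarrow> (nat \<Rightarrow> complex) \<Rightarrow> nat \<Rightarrow> nat \<Rightarrow> complex" where
  "moment_matrix p b c \<eta> n i = moment b c \<eta> (i mod p + 1) (n + i div p)"

lemma moment_matrix_entry:
  assumes "a \<in> {1..p}"
  shows "moment_matrix p b c \<eta> n (p * l + a - 1) = moment b c \<eta> a (n + l)"
proof -
  from assms obtain r where "a = Suc r" "r < p"
    by (cases a) auto
  then show ?thesis
    by (simp add: moment_matrix_def)
qed


section \<open>Semi-infinite matrices and the Gauss--Borel factorization\<close>

type_synonym cmatrix = "nat \<Rightarrow> nat \<Rightarrow> complex"

definition lower_unitriangular :: "cmatrix \<Rightarrow> bool" where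
  "lower_unitriangular A \<longleftrightarrow> (\<forall>n. A n n = 1) \<and> (\<forall>n k. n < k \<longrightarrow> A n k = 0)"

definition id_matrix :: cmatrix where
  "id_matrix n k = (if n = k then 1 else 0)"

definition diag_matrix :: "(nat \<Rightarrow> complex) \<Rightarrow> cmatrix" where
  "diag_matrix d n k = (if n = k then d n else 0)"

definition transp_matrix :: "cmatrix \<Rightarrow> cmatrix" where
  "transp_matrix A n k = A k n"

text \<open>
  The product of two semi-infinite matrices whose left factor is lower triangular: the entries of
  row \<open>n\<close> of \<open>A\<close> beyond column \<open>n\<close> vanish, so the sum may stop at \<open>n\<close>.
\<close>

definition lt_mult :: "cmatrix \<Rightarrow> cmatrix \<Rightarrow> cmatrix" where
  "lt_mult A B n k = (\<Sum>i\<le>n. A n i * B i k)"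

definition is_lt_inverse :: "cmatrix \<Rightarrow> cmatrix \<Rightarrow> bool" where
  "is_lt_inverse A B \<longleftrightarrow>
     lower_unitriangular B \<and> lt_mult A B = id_matrix \<and> lt_mult B A = id_matrix"

definition lt_inv :: "cmatrix \<Rightarrow> cmatrix" where
  "lt_inv A = (THE B. is_lt_inverse A B)"

definition gauss_borel :: "cmatrix \<Rightarrow> cmatrix \<Rightarrow> (nat \<Rightarrow> complex) \<Rightarrow> cmatrix \<Rightarrow> bool" where
  "gauss_borel A S H T \<longleftrightarrow>
     lower_unitriangular S \<and> lower_unitriangular T \<and> (\<forall>n. H n \<noteq> 0) \<and>
     A = lt_mult (lt_inv S) (lt_mult (diag_matrix H) (transp_matrix (lt_inv T)))"

text \<open>
  The functions \<open>f\<^sup>(\<^sup>m\<^sup>)\<^sub>n\<close>: the entry in row \<open>n + \<bar>m\<bar>\<close> and column \<open>n\<close> of \<open>S\<close> if \<open>m > 0\<close> and of the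
  inverse of \<open>S\<close> if \<open>m < 0\<close>, with the convention that it vanishes for \<open>n = -1\<close> and \<open>m \<noteq> 0\<close>.
\<close>

definition subdiag :: "cmatrix \<Rightarrow> int \<Rightarrow> int \<Rightarrow> complex" where
  "subdiag S m n =
     (if m = 0 then 1
      else if n < 0 then 0
      else if m > 0 then S (nat (n + m)) (nat n)
      else lt_inv S (nat (n - m)) (nat n))"


section \<open>The Euler operator and local branches of the logarithm\<close>

definition theta :: "nat \<Rightarrow> ((nat \<Rightarrow> complex) \<Rightarrow> complex) \<Rightarrow> (nat \<Rightarrow> complex) \<Rightarrow> complex" where
  "theta p F \<eta> = (\<Sum>a=1..p. \<eta> a * deriv (\<lambda>z. F (\<eta>(a := z))) (\<eta> a))"

text \<open>\<^const>\<open>deriv\<close> is a total operator; this predicate says that all derivatives in \<^const>\<open>theta\<close> exist.\<close>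

definition partially_differentiable ::
  "nat \<Rightarrow> ((nat \<Rightarrow> complex) \<Rightarrow> complex) \<Rightarrow> (nat \<Rightarrow> complex) \<Rightarrow> bool" where
  "partially_differentiable p F \<eta> \<longleftrightarrow>
     (\<forall>a\<in>{1..p}. (\<lambda>z. F (\<eta>(a := z))) field_differentiable at (\<eta> a))"

definition local_log_branch ::
  "nat \<Rightarrow> ((nat \<Rightarrow> complex) \<Rightarrow> complex) \<Rightarrow> ((nat \<Rightarrow> complex) \<Rightarrow> complex) \<Rightarrow> (nat \<Rightarrow> complex) \<Rightarrow> bool"
where
  "local_log_branch p h q \<eta> \<longleftrightarrow>
     (\<exists>V. openin (eta_space p) V \<and> \<eta> \<in> V \<and>
          continuous_map (subtopology (eta_space p) V) euclidean q \<and>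
          (\<forall>\<xi>\<in>V. exp (q \<xi>) = h \<xi>))"


section \<open>The inverse of a lower unitriangular matrix\<close>

lemma lt_mult_id_left: "lt_mult id_matrix A = A"
  by (simp add: lt_mult_def id_matrix_def fun_eq_iff if_distrib[of "\<lambda>x. x * _"] cong: if_cong)

lemma lt_mult_id_right:
  assumes "lower_unitriangular A"
  shows "lt_mult A id_matrix = A"
  using assms
  by (auto simp: lt_mult_def id_matrix_def fun_eq_iff lower_unitriangular_def
      if_distrib[of "\<lambda>x. _ * x"] cong: if_cong)

lemma lt_mult_assoc:
  assumes "lower_unitriangular A" "lower_unitriangular B"
  shows "lt_mult (lt_mult A B) C = lt_mult A (lt_mult B C)"
proof (intro ext)
  fix n k
  have *: "(\<Sum>i\<le>j. B j i * C i k) = (\<Sum>i\<le>n. B j i * C i k)" if "j \<le> n" for j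
    using that assms(2) by (intro sum.mono_neutral_left) (auto simp: lower_unitriangular_def)
  have "lt_mult (lt_mult A B) C n k = (\<Sum>i\<le>n. \<Sum>j\<le>n. A n j * (B j i * C i k))"
    by (simp add: lt_mult_def sum_distrib_right mult.assoc)
  also have "\<dots> = (\<Sum>j\<le>n. A n j * (\<Sum>i\<le>n. B j i * C i k))"
    by (subst sum.swap) (simp add: sum_distrib_left)
  also have "\<dots> = lt_mult A (lt_mult B C) n k"
    by (simp add: lt_mult_def *)
  finally show "lt_mult (lt_mult A B) C n k = lt_mult A (lt_mult B C) n k" .
qed

fun lt_right_inv :: "cmatrix \<Rightarrow> nat \<Rightarrow> nat \<Rightarrow> complex" where
  "lt_right_inv A n k =
     (if n = k then 1 else if n < k then 0 else - (\<Sum>i<n. A n i * lt_right_inv A i k))"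

declare lt_right_inv.simps [simp del]

lemma lower_unitriangular_right_inv: "lower_unitriangular (lt_right_inv A)"
  by (simp add: lower_unitriangular_def lt_right_inv.simps)

lemma lt_mult_right_inv:
  assumes "lower_unitriangular A"
  shows "lt_mult A (lt_right_inv A) = id_matrix"
proof (intro ext)
  fix n k
  have "lt_mult A (lt_right_inv A) n k = (\<Sum>i<n. A n i * lt_right_inv A i k) + lt_right_inv A n k"
    using assms by (simp add: lt_mult_def lower_unitriangular_def flip: lessThan_Suc_atMost)
  also have "\<dots> = id_matrix n k"
  proof (cases "n \<le> k")
    case True
    then have "(\<Sum>i<n. A n i * lt_right_inv A i k) = 0"
      by (intro sum.neutral) (auto simp: lt_right_inv.simps)
    with True show ?thesis
      by (auto simp: id_matrix_def lt_right_inv.simps)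
  next
    case False
    then have "lt_right_inv A n k = - (\<Sum>i<n. A n i * lt_right_inv A i k)"
      by (subst lt_right_inv.simps) simp
    with False show ?thesis
      by (simp add: id_matrix_def)
  qed
  finally show "lt_mult A (lt_right_inv A) n k = id_matrix n k" .
qed

lemma is_lt_inverse_unique:
  assumes "lower_unitriangular A" "is_lt_inverse A B" "is_lt_inverse A C"
  shows "B = C"
proof -
  have "B = lt_mult B (lt_mult A C)"
    using assms by (simp add: is_lt_inverse_def lt_mult_id_right)
  also have "\<dots> = lt_mult (lt_mult B A) C"
    using assms by (intro lt_mult_assoc[symmetric]) (auto simp: is_lt_inverse_def)
  also have "\<dots> = C"
    using assms by (simp add: is_lt_inverse_def lt_mult_id_left)
  finally show ?thesis .
qed

lemma is_lt_inverse_lt_inv: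
  assumes A: "lower_unitriangular A"
  shows "is_lt_inverse A (lt_inv A)"
proof -
  let ?B = "lt_right_inv A"
  let ?C = "lt_right_inv ?B"
  have B: "lower_unitriangular ?B"
    by (rule lower_unitriangular_right_inv)
  have AB: "lt_mult A ?B = id_matrix"
    by (rule lt_mult_right_inv[OF A])
  have BC: "lt_mult ?B ?C = id_matrix"
    by (rule lt_mult_right_inv[OF B])
  have "A = lt_mult A (lt_mult ?B ?C)"
    using A BC by (simp add: lt_mult_id_right)
  also have "\<dots> = lt_mult (lt_mult A ?B) ?C"
    using A B by (simp add: lt_mult_assoc)
  also have "\<dots> = ?C"
    using AB by (simp add: lt_mult_id_left)
  finally have "is_lt_inverse A ?B"
    using AB B BC by (simp add: is_lt_inverse_def)
  then show ?thesis
    unfolding lt_inv_def using is_lt_inverse_unique[OF A] by (metis theI)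
qed

end

theory Submission
  imports Defs
begin

text \<open>
  Euler's operator raises the order of the moments, so \<open>\<vartheta>M = \<Lambda>M\<close>, while the arrangement of the
  columns gives \<open>\<Lambda>M = M(\<Lambda>\<^sup>T)\<^sup>p\<close>. Let \<open>R\<close> be the inverse of the second unitriangular factor. Applying
  \<open>\<vartheta>\<close> to \<open>SM = H R\<^sup>T\<close> shows that \<open>((\<vartheta>S) S\<inverse> + S\<Lambda>S\<inverse>) H R\<^sup>T\<close> is upper triangular with diagonal \<open>\<vartheta>H\<close>;
  as \<open>R\<^sup>T\<close> is upper unitriangular, the same holds for \<open>((\<vartheta>S) S\<inverse> + S\<Lambda>S\<inverse>) H\<close>. Likewise
  \<open>(S\<Lambda>S\<inverse>) H R\<^sup>T = H R\<^sup>T (\<Lambda>\<^sup>T)\<^sup>p\<close> shows that the lowest nonzero diagonal of \<open>S\<Lambda>S\<inverse>\<close> is the p-th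
  subdiagonal, with entries \<open>H\<^sub>n\<^sub>+\<^sub>p / H\<^sub>n\<close>.
\<close>

section \<open>Calculus of the Euler operator\<close>

text \<open>The curve \<open>z \<mapsto> \<eta>(a := z)\<close> is continuous into the product
  space, as \<open>a \<in> {1..p}\<close> keeps it extensional, so the preimage of \<open>U\<close>
  is open. Identities are available only on \<open>U\<close>; this is what allows them to be
  differentiated at \<open>\<eta>\<close>.\<close>

lemma eventually_fun_upd_openin:
  assumes U: "openin (eta_space p) U" and \<eta>: "\<eta> \<in> U" and a: "a \<in> {1..p}"
  shows "eventually (\<lambda>z. \<eta>(a := z) \<in> U) (nhds (\<eta> a))"
proof -
  have "\<eta> \<in> topspace (eta_space p)"
    using openin_subset[OF U] \<eta> by blast
  then have ext: "\<eta> \<in> extensional {1..p}"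
    by (simp add: PiE_def)
  have "continuous_map euclidean (eta_space p) (\<lambda>z. \<eta>(a := z))"
    unfolding continuous_map_componentwise
  proof (intro conjI ballI)
    show "(\<lambda>z. \<eta>(a := z)) ` topspace euclidean \<subseteq> extensional {1..p}"
      using ext a by (auto simp: extensional_def)
    show "continuous_map euclidean euclidean (\<lambda>z. (\<eta>(a := z)) k)" if "k \<in> {1..p}" for k
      by (cases "k = a") auto
  qed
  then have "openin euclidean {z \<in> topspace euclidean. \<eta>(a := z) \<in> U}"
    using U by (rule openin_continuous_map_preimage)
  then have "open {z. \<eta>(a := z) \<in> U}"
    by simp
  moreover have "\<eta> a \<in> {z. \<eta>(a := z) \<in> U}"
    using \<eta> by simp
  ultimately show ?thesis
    by (metis (mono_tags, lifting) eventually_nhds mem_Collect_eq)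
qed

lemma eventually_eq_fun_upd:
  assumes "openin (eta_space p) U" "\<eta> \<in> U" "\<And>\<xi>. \<xi> \<in> U \<Longrightarrow> F \<xi> = G \<xi>" "a \<in> {1..p}"
  shows "eventually (\<lambda>z. F (\<eta>(a := z)) = G (\<eta>(a := z))) (nhds (\<eta> a))"
  using eventually_fun_upd_openin[OF assms(1,2,4)] by eventually_elim (rule assms(3))

lemma partially_differentiable_cong:
  assumes "openin (eta_space p) U" "\<eta> \<in> U" "\<And>\<xi>. \<xi> \<in> U \<Longrightarrow> F \<xi> = G \<xi>"
  shows "partially_differentiable p F \<eta> \<longleftrightarrow> partially_differentiable p G \<eta>"
proof -
  have "(\<lambda>z. F (\<eta>(a := z))) field_differentiable at (\<eta> a) \<longleftrightarrow>
        (\<lambda>z. G (\<eta>(a := z))) field_differentiable at (\<eta> a)" if "a \<in> {1..p}" for a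
    unfolding field_differentiable_def
    using eventually_eq_fun_upd[where F = F and G = G, OF assms that] by (simp cong: DERIV_cong_ev)
  then show ?thesis
    by (simp add: partially_differentiable_def)
qed

lemma theta_cong:
  assumes "openin (eta_space p) U" "\<eta> \<in> U" "\<And>\<xi>. \<xi> \<in> U \<Longrightarrow> F \<xi> = G \<xi>"
  shows "theta p F \<eta> = theta p G \<eta>"
  unfolding theta_def
  by (intro sum.cong refl arg_cong2[where f = "(*)"] deriv_cong_ev eventually_eq_fun_upd[OF assms])

lemma partially_differentiable_const: "partially_differentiable p (\<lambda>\<xi>. x) \<eta>"
  by (simp add: partially_differentiable_def)

lemma partially_differentiable_diff:
  "partially_differentiable p F \<eta> \<Longrightarrow> partially_differentiable p G \<eta> \<Longrightarrow>
   partially_differentiable p (\<lambda>\<xi>. F \<xi> - G \<xi>) \<eta>"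
  by (simp add: partially_differentiable_def field_differentiable_diff)

lemma partially_differentiable_mult:
  "partially_differentiable p F \<eta> \<Longrightarrow> partially_differentiable p G \<eta> \<Longrightarrow>
   partially_differentiable p (\<lambda>\<xi>. F \<xi> * G \<xi>) \<eta>"
  by (simp add: partially_differentiable_def field_differentiable_mult)

lemma partially_differentiable_divide:
  "partially_differentiable p F \<eta> \<Longrightarrow> partially_differentiable p G \<eta> \<Longrightarrow> G \<eta> \<noteq> 0 \<Longrightarrow>
   partially_differentiable p (\<lambda>\<xi>. F \<xi> / G \<xi>) \<eta>"
  by (simp add: partially_differentiable_def field_differentiable_divide)

lemma partially_differentiable_sum:
  "(\<And>i. i \<in> I \<Longrightarrow> partially_differentiable p (F i) \<eta>) \<Longrightarrow>
   partially_differentiable p (\<lambda>\<xi>. \<Sum>i\<in>I. F i \<xi>) \<eta>"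
  by (simp add: partially_differentiable_def field_differentiable_sum)

lemma theta_const: "theta p (\<lambda>\<xi>. x) \<eta> = 0"
  by (simp add: theta_def)

lemma theta_mult:
  assumes "partially_differentiable p F \<eta>" "partially_differentiable p G \<eta>"
  shows "theta p (\<lambda>\<xi>. F \<xi> * G \<xi>) \<eta> = theta p F \<eta> * G \<eta> + F \<eta> * theta p G \<eta>"
proof -
  have "theta p (\<lambda>\<xi>. F \<xi> * G \<xi>) \<eta> =
      (\<Sum>a=1..p. \<eta> a * deriv (\<lambda>z. F (\<eta>(a := z))) (\<eta> a) * G \<eta>
        + F \<eta> * (\<eta> a * deriv (\<lambda>z. G (\<eta>(a := z))) (\<eta> a)))"
    unfolding theta_def using assms
    by (intro sum.cong) (auto simp: partially_differentiable_def algebra_simps)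
  then show ?thesis
    by (simp only: theta_def sum.distrib sum_distrib_left sum_distrib_right)
qed

lemma theta_sum:
  assumes "\<And>i. i \<in> I \<Longrightarrow> partially_differentiable p (F i) \<eta>"
  shows "theta p (\<lambda>\<xi>. \<Sum>i\<in>I. F i \<xi>) \<eta> = (\<Sum>i\<in>I. theta p (F i) \<eta>)"
proof -
  have "deriv (\<lambda>z. \<Sum>i\<in>I. F i (\<eta>(a := z))) (\<eta> a) = (\<Sum>i\<in>I. deriv (\<lambda>z. F i (\<eta>(a := z))) (\<eta> a))"
    if "a \<in> {1..p}" for a
    using assms that
    by (intro DERIV_imp_deriv DERIV_sum field_differentiable_derivI)
      (auto simp: partially_differentiable_def)
  then have "theta p (\<lambda>\<xi>. \<Sum>i\<in>I. F i \<xi>) \<eta> =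
      (\<Sum>a=1..p. \<Sum>i\<in>I. \<eta> a * deriv (\<lambda>z. F i (\<eta>(a := z))) (\<eta> a))"
    by (simp add: theta_def sum_distrib_left)
  then show ?thesis
    by (subst (asm) sum.swap) (simp add: theta_def)
qed

lemma theta_exp:
  assumes "partially_differentiable p F \<eta>"
  shows "theta p (\<lambda>\<xi>. exp (F \<xi>)) \<eta> = exp (F \<eta>) * theta p F \<eta>"
proof -
  have "deriv (\<lambda>z. exp (F (\<eta>(a := z)))) (\<eta> a) = exp (F \<eta>) * deriv (\<lambda>z. F (\<eta>(a := z))) (\<eta> a)"
    if "a \<in> {1..p}" for a
  proof (rule DERIV_imp_deriv)
    have "((\<lambda>z. F (\<eta>(a := z))) has_field_derivative deriv (\<lambda>z. F (\<eta>(a := z))) (\<eta> a)) (at (\<eta> a))"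
      using assms that by (simp add: partially_differentiable_def field_differentiable_derivI)
    then show "((\<lambda>z. exp (F (\<eta>(a := z)))) has_field_derivative
        exp (F \<eta>) * deriv (\<lambda>z. F (\<eta>(a := z))) (\<eta> a)) (at (\<eta> a))"
      by (rule DERIV_fun_exp[THEN DERIV_cong]) simp
  qed
  then show ?thesis
    by (simp add: theta_def sum_distrib_left mult_ac)
qed

text \<open>Near the point, a continuous branch \<open>q\<close> equals \<open>q \<eta> + Ln (h / h \<eta>)\<close> for the principal \<open>Ln\<close>.\<close>

lemma partially_differentiable_log_branch:
  assumes q: "local_log_branch p h q \<eta>" and h: "partially_differentiable p h \<eta>"
  shows "partially_differentiable p q \<eta>"
proof -
  from q obtain V where V: "openin (eta_space p) V" "\<eta> \<in> V"
      "continuous_map (subtopology (eta_space p) V) euclidean q"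
      and exp_q: "\<And>\<xi>. \<xi> \<in> V \<Longrightarrow> exp (q \<xi>) = h \<xi>"
    unfolding local_log_branch_def by blast
  have "openin (subtopology (eta_space p) V)
      {\<xi> \<in> topspace (subtopology (eta_space p) V). q \<xi> \<in> ball (q \<eta>) 1}"
    using V(3) by (rule openin_continuous_map_preimage) (rule open_openin[THEN iffD1, OF open_ball])
  then have W: "openin (eta_space p) {\<xi> \<in> topspace (subtopology (eta_space p) V). q \<xi> \<in> ball (q \<eta>) 1}"
    (is "openin _ ?W") using V(1) by (rule openin_trans_full)
  have \<eta>W: "\<eta> \<in> ?W"
    using V(1,2) openin_subset by fastforce
  have eq: "q \<xi> = q \<eta> + Ln (h \<xi> / h \<eta>)" if "\<xi> \<in> ?W" for \<xi>
  proof -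
    \<comment> \<open>Radius 1 is below \<open>pi\<close>, so the difference lies in the strip where
      the principal \<open>Ln\<close> inverts \<open>exp\<close>.\<close>
    have "\<bar>Im (q \<xi> - q \<eta>)\<bar> < 1"
      using that abs_Im_le_cmod[of "q \<xi> - q \<eta>"] by (simp add: dist_norm norm_minus_commute)
    then have "Ln (exp (q \<xi> - q \<eta>)) = q \<xi> - q \<eta>"
      using pi_gt3 by (intro Ln_exp) auto
    moreover have "exp (q \<xi> - q \<eta>) = h \<xi> / h \<eta>"
      using that V(2) exp_q by (simp add: exp_diff)
    ultimately show ?thesis
      by simp
  qed
  have h\<eta>: "h \<eta> \<noteq> 0"
    using exp_q[OF V(2)] by (metis exp_not_eq_zero)
  have "partially_differentiable p (\<lambda>\<xi>. q \<eta> + Ln (h \<xi> / h \<eta>)) \<eta>"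
    unfolding partially_differentiable_def
  proof
    fix a assume "a \<in> {1..p}"
    then have "(\<lambda>z. h (\<eta>(a := z))) field_differentiable at (\<eta> a)"
      using h by (simp add: partially_differentiable_def)
    then obtain D where "((\<lambda>z. h (\<eta>(a := z))) has_field_derivative D) (at (\<eta> a))"
      by (auto simp: field_differentiable_def)
    \<comment> \<open>At \<open>\<eta>\<close> the quotient equals 1, which is off the branch cut of
      \<open>Ln\<close>.\<close>
    then have "((\<lambda>z. q \<eta> + Ln (h (\<eta>(a := z)) / h \<eta>)) has_field_derivative D / h \<eta>) (at (\<eta> a))"
      using h\<eta> by (auto intro!: derivative_eq_intros)
    then show "(\<lambda>z. q \<eta> + Ln (h (\<eta>(a := z)) / h \<eta>)) field_differentiable at (\<eta> a)"
      by (auto simp: field_differentiable_def)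
  qed
  then show ?thesis
    using partially_differentiable_cong[OF W \<eta>W eq] by simp
qed

lemma theta_log_branch:
  assumes q: "local_log_branch p h q \<eta>" and h: "partially_differentiable p h \<eta>"
  shows "theta p h \<eta> = h \<eta> * theta p q \<eta>"
proof -
  from q obtain V where V: "openin (eta_space p) V" "\<eta> \<in> V"
    and exp_q: "\<And>\<xi>. \<xi> \<in> V \<Longrightarrow> h \<xi> = exp (q \<xi>)"
    unfolding local_log_branch_def by metis
  have "theta p h \<eta> = theta p (\<lambda>\<xi>. exp (q \<xi>)) \<eta>"
    by (rule theta_cong[OF V exp_q])
  then show ?thesis
    using theta_exp[OF partially_differentiable_log_branch[OF assms]] exp_q[OF V(2)] by simp
qed


section \<open>The Euler operator on the moments\<close>

text \<open>In the single variable \<open>\<eta> a\<close> the moment is a power series. Termwise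
  differentiation followed by multiplication with \<open>\<eta> a\<close> multiplies the k-th term
  by k, which raises the order of the moment by one.\<close>

lemma moment_has_field_derivative:
  assumes U: "openin (eta_space p) U" and \<eta>: "\<eta> \<in> U" and a: "a \<in> {1..p}"
    and sm: "\<And>\<xi> m. \<xi> \<in> U \<Longrightarrow> summable (\<lambda>k. of_nat k ^ m * weight b c \<xi> a k)"
  obtains D where "((\<lambda>z. moment b c (\<eta>(a := z)) a m) has_field_derivative D) (at (\<eta> a))"
    and "\<eta> a * D = moment b c \<eta> a (Suc m)"
proof -
  define C :: "nat \<Rightarrow> complex" where
    "C k = of_nat k ^ m * ((\<Prod>x\<leftarrow>b a. pochhammer x k) / (\<Prod>x\<leftarrow>c. pochhammer x k) / fact k)" for k
  have C: "of_nat k ^ m * weight b c (\<eta>(a := z)) a k = C k * z ^ k" for z k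
    by (simp add: C_def weight_def)
  obtain e where e: "e > 0" and eU: "\<And>z. dist z (\<eta> a) < e \<Longrightarrow> \<eta>(a := z) \<in> U"
    using eventually_fun_upd_openin[OF U \<eta> a] by (auto simp: eventually_nhds_metric)
  \<comment> \<open>Termwise differentiation needs convergence at a point of strictly larger
    modulus. Moving radially outward by \<open>e / 2\<close> stays in the neighbourhood; at the
    origin, where no radial direction exists, the point \<open>e / 2\<close> itself serves.\<close>
  obtain K where K: "dist K (\<eta> a) < e" "norm (\<eta> a) < norm K"
  proof (cases "\<eta> a = 0")
    case True
    then show ?thesis
      using e that[of "of_real (e / 2)"] by simp
  next
    case False
    define t where "t = e / (2 * norm (\<eta> a))"
    have t: "t > 0"
      using e False by (simp add: t_def)
    have "norm (of_real t * \<eta> a) = t * norm (\<eta> a)"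
      using t by (simp only: norm_mult norm_of_real)
    then have "norm (of_real t * \<eta> a) = e / 2"
      using False by (simp add: t_def)
    moreover have "norm (of_real (1 + t) * \<eta> a) = (1 + t) * norm (\<eta> a)"
      using t by (simp only: norm_mult norm_of_real)
    moreover have "norm (\<eta> a) < (1 + t) * norm (\<eta> a)"
      using t False by (simp add: distrib_right)
    ultimately show ?thesis
      using e that[of "of_real (1 + t) * \<eta> a"] by (simp add: dist_norm distrib_right)
  qed
  have "summable (\<lambda>k. C k * K ^ k)"
    using sm[OF eU[OF K(1)], of m] by (simp add: C)
  then have der: "((\<lambda>z. \<Sum>k. C k * z ^ k) has_field_derivative (\<Sum>k. diffs C k * \<eta> a ^ k)) (at (\<eta> a))"
    and sums: "(\<lambda>k. diffs C k * \<eta> a ^ k) sums (\<Sum>k. diffs C k * \<eta> a ^ k)"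
    using K(2) by (auto intro: termdiffs_strong summable_sums termdiff_converges powser_inside)
  show ?thesis
  proof (rule that)
    show "((\<lambda>z. moment b c (\<eta>(a := z)) a m) has_field_derivative (\<Sum>k. diffs C k * \<eta> a ^ k)) (at (\<eta> a))"
      using der by (simp add: moment_def C)
    have "(\<lambda>k. \<eta> a * (diffs C k * \<eta> a ^ k)) sums (\<eta> a * (\<Sum>k. diffs C k * \<eta> a ^ k))"
      by (intro sums_mult sums)
    then have "(\<lambda>k. of_nat (Suc k) * C (Suc k) * \<eta> a ^ Suc k) sums (\<eta> a * (\<Sum>k. diffs C k * \<eta> a ^ k))"
      by (simp add: diffs_def mult_ac)
    \<comment> \<open>Re-indexing adds the term k = 0, which vanishes because of its factor
      k.\<close>
    then have "(\<lambda>k. of_nat k * C k * \<eta> a ^ k) sums (\<eta> a * (\<Sum>k. diffs C k * \<eta> a ^ k))"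
      by (subst (asm) sums_Suc_iff) simp
    moreover have "of_nat k * C k * \<eta> a ^ k = of_nat k ^ Suc m * weight b c \<eta> a k" for k
      using C[of k "\<eta> a"] by (simp add: mult.assoc)
    ultimately show "\<eta> a * (\<Sum>k. diffs C k * \<eta> a ^ k) = moment b c \<eta> a (Suc m)"
      by (simp add: moment_def sums_iff)
  qed
qed

lemma moment_fun_upd_other:
  "a' \<noteq> a \<Longrightarrow> moment b c (\<eta>(a' := z)) a m = moment b c \<eta> a m"
  by (simp add: moment_def weight_def)

text \<open>The a-th weight depends on \<open>\<eta> a\<close> alone, so only the a-th summand of
  \<open>theta\<close> contributes.\<close>

lemma
  assumes U: "openin (eta_space p) U" and \<eta>: "\<eta> \<in> U" and a: "a \<in> {1..p}"
    and sm: "\<And>\<xi> m. \<xi> \<in> U \<Longrightarrow> summable (\<lambda>k. of_nat k ^ m * weight b c \<xi> a k)"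
  shows partially_differentiable_moment: "partially_differentiable p (\<lambda>\<xi>. moment b c \<xi> a m) \<eta>"
    and theta_moment: "theta p (\<lambda>\<xi>. moment b c \<xi> a m) \<eta> = moment b c \<eta> a (Suc m)"
proof -
  obtain D where D: "((\<lambda>z. moment b c (\<eta>(a := z)) a m) has_field_derivative D) (at (\<eta> a))"
    "\<eta> a * D = moment b c \<eta> a (Suc m)"
    using moment_has_field_derivative[OF U \<eta> a sm] .
  show "partially_differentiable p (\<lambda>\<xi>. moment b c \<xi> a m) \<eta>"
    unfolding partially_differentiable_def
  proof
    fix a' assume "a' \<in> {1..p}"
    then show "(\<lambda>z. moment b c (\<eta>(a' := z)) a m) field_differentiable at (\<eta> a')"
      using D(1) by (cases "a' = a") (auto simp: moment_fun_upd_other field_differentiable_def)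
  qed
  have "theta p (\<lambda>\<xi>. moment b c \<xi> a m) \<eta> = (\<Sum>a'=1..p. if a' = a then \<eta> a * D else 0)"
    unfolding theta_def
    by (intro sum.cong) (auto simp: moment_fun_upd_other DERIV_imp_deriv[OF D(1)])
  then show "theta p (\<lambda>\<xi>. moment b c \<xi> a m) \<eta> = moment b c \<eta> a (Suc m)"
    using a D(2) by simp
qed


section \<open>Consequences of the Gauss--Borel factorization\<close>

lemma lower_unitriangular_lt_inv:
  "lower_unitriangular A \<Longrightarrow> lower_unitriangular (lt_inv A)"
  using is_lt_inverse_lt_inv by (simp add: is_lt_inverse_def)

lemma gauss_borel_unitriangular:
  assumes "gauss_borel A S H T"
  shows "lower_unitriangular S" "lower_unitriangular T"
    "lower_unitriangular (lt_inv S)" "lower_unitriangular (lt_inv T)"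
  using assms by (auto simp: gauss_borel_def lower_unitriangular_lt_inv)

text \<open>The sum stops at the column index because the transpose of \<open>lt_inv T\<close> is
  upper triangular. A range independent of the row is what later permits interchanging this sum with
  a sum over rows.\<close>

lemma gauss_borel_entry:
  assumes "gauss_borel A S H T"
  shows "A n k = (\<Sum>i\<le>k. lt_inv S n i * H i * lt_inv T k i)"
proof -
  have L: "lower_unitriangular (lt_inv S)" "lower_unitriangular (lt_inv T)"
    using gauss_borel_unitriangular[OF assms] by auto
  have "A n k = lt_mult (lt_inv S) (lt_mult (diag_matrix H) (transp_matrix (lt_inv T))) n k"
    using assms by (metis gauss_borel_def)
  also have "\<dots> = (\<Sum>i\<le>n. lt_inv S n i * H i * lt_inv T k i)"
    by (simp add: lt_mult_def diag_matrix_def transp_matrix_def mult.assoc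
        if_distrib[of "\<lambda>x. x * _"] cong: if_cong)
  \<comment> \<open>The common range \<open>max n k\<close> contains both truncations; triangularity
    of one factor extends the sum, that of the other cuts it.\<close>
  also have "\<dots> = (\<Sum>i\<le>max n k. lt_inv S n i * H i * lt_inv T k i)"
    using L by (intro sum.mono_neutral_left) (auto simp: lower_unitriangular_def)
  also have "\<dots> = (\<Sum>i\<le>k. lt_inv S n i * H i * lt_inv T k i)"
    using L by (intro sum.mono_neutral_right) (auto simp: lower_unitriangular_def)
  finally show ?thesis .
qed

lemma gauss_borel_left_mult_entry:
  assumes "gauss_borel A S H T"
  shows "(\<Sum>i\<le>n. S n i * A i k) = H n * lt_inv T k n"
proof -
  let ?B = "lt_mult (diag_matrix H) (transp_matrix (lt_inv T))"
  have S: "lower_unitriangular S" and A: "A = lt_mult (lt_inv S) ?B"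
    using assms by (auto simp: gauss_borel_def)
  have "lt_mult S A = lt_mult (lt_mult S (lt_inv S)) ?B"
    unfolding A using S by (simp add: lt_mult_assoc lower_unitriangular_lt_inv)
  also have "\<dots> = ?B"
    using is_lt_inverse_lt_inv[OF S] by (simp add: is_lt_inverse_def lt_mult_id_left)
  finally have "lt_mult S A n k = ?B n k"
    by simp
  then show ?thesis
    by (simp add: lt_mult_def diag_matrix_def transp_matrix_def
        if_distrib[of "\<lambda>x. x * _"] cong: if_cong)
qed

text \<open>Forward substitution for the row vector \<open>x\<close> times the transpose of
  \<open>R\<close>: the k-th entry of the product is \<open>x k\<close> plus multiples of earlier
  entries of \<open>x\<close>. If the product vanishes before position \<open>N\<close>, so does
  \<open>x\<close>, and both agree at \<open>N\<close>.\<close>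

lemma lower_unitriangular_first_nonzero:
  fixes x :: "nat \<Rightarrow> complex"
  assumes R: "lower_unitriangular R" and zero: "\<And>k. k < N \<Longrightarrow> (\<Sum>j\<le>k. x j * R k j) = 0"
  shows "(\<Sum>j\<le>N. x j * R N j) = x N"
proof -
  have *: "(\<Sum>j\<le>k. x j * R k j) = x k" if "\<And>j. j < k \<Longrightarrow> x j = 0" for k
    using that R by (simp add: lower_unitriangular_def flip: lessThan_Suc_atMost)
  have "x k = 0" if "k < N" for k
    using that
  proof (induction k rule: less_induct)
    case (less k)
    then have "x j = 0" if "j < k" for j
      using that by simp
    then show ?case
      using * zero less.prems by metis
  qed
  then show ?thesis
    by (rule *)
qed

text \<open>By \<open>shift\<close>, applying row \<open>n + p\<close> of \<open>S\<close> to the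
  row-shifted \<open>A\<close> gives row \<open>n + p\<close> of \<open>H\<close> times the
  transpose of \<open>lt_inv T\<close>, moved \<open>p\<close> columns to the left. It therefore
  starts at column \<open>n\<close>, and forward substitution strips off the factor
  \<open>lt_inv T\<close>.\<close>

lemma lax_lowest_diagonal:
  assumes gb: "gauss_borel A S H T" and shift: "\<And>n k. A (Suc n) k = A n (k + p)"
  shows "(\<Sum>i\<le>n + p. S (n + p) i * lt_inv S (Suc i) n) * H n = H (n + p)"
proof -
  define x where "x k = (\<Sum>i\<le>n + p. S (n + p) i * lt_inv S (Suc i) k) * H k" for k
  have x: "(\<Sum>j\<le>k. x j * lt_inv T k j) = H (n + p) * lt_inv T (k + p) (n + p)" for k
  proof -
    have "H (n + p) * lt_inv T (k + p) (n + p) = (\<Sum>i\<le>n + p. S (n + p) i * A (Suc i) k)"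
      by (simp add: shift gauss_borel_left_mult_entry[OF gb])
    also have "\<dots> = (\<Sum>j\<le>k. x j * lt_inv T k j)"
      unfolding gauss_borel_entry[OF gb] sum_distrib_left
      by (subst sum.swap) (simp add: x_def sum_distrib_right mult.assoc)
    finally show ?thesis ..
  qed
  \<comment> \<open>For k < n the entry of \<open>lt_inv T\<close> at \<open>(k + p, n + p)\<close>
    lies above the diagonal and is 0; for k = n it is 1.\<close>
  have "(\<Sum>j\<le>n. x j * lt_inv T n j) = x n"
    using gauss_borel_unitriangular(4)[OF gb]
    by (intro lower_unitriangular_first_nonzero gauss_borel_unitriangular(4)[OF gb]) (simp add: x lower_unitriangular_def)
  then show ?thesis
    using x[of n] gauss_borel_unitriangular(4)[OF gb] by (simp add: x_def lower_unitriangular_def)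
qed

section \<open>Differentiability of the Gauss-Borel factors\<close>

context
  fixes p :: nat and U :: "(nat \<Rightarrow> complex) set" and \<eta> :: "nat \<Rightarrow> complex"
    and A S T :: "(nat \<Rightarrow> complex) \<Rightarrow> cmatrix" and H :: "(nat \<Rightarrow> complex) \<Rightarrow> nat \<Rightarrow> complex"
  assumes U: "openin (eta_space p) U" and \<eta>: "\<eta> \<in> U"
    and gb: "\<And>\<xi>. \<xi> \<in> U \<Longrightarrow> gauss_borel (A \<xi>) (S \<xi>) (H \<xi>) (T \<xi>)"
    and A: "\<And>n k. partially_differentiable p (\<lambda>\<xi>. A \<xi> n k) \<eta>"
begin

lemmas unitriangular = gauss_borel_unitriangular[OF gb]

lemma partially_differentiable_transfer:
  assumes "\<And>\<xi>. \<xi> \<in> U \<Longrightarrow> F \<xi> = G \<xi>" "partially_differentiable p G \<eta>"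
  shows "partially_differentiable p F \<eta>"
  using partially_differentiable_cong[where F = F and G = G, OF U \<eta> assms(1)] assms(2) by simp

lemma diagonal_nonzero: "\<xi> \<in> U \<Longrightarrow> H \<xi> n \<noteq> 0"
  using gb by (auto simp: gauss_borel_def)

text \<open>Gaussian elimination expresses the k-th columns of the factors rationally through the previous ones.\<close>

lemma partially_differentiable_factors:
  "partially_differentiable p (\<lambda>\<xi>. H \<xi> k) \<eta> \<and>
   (\<forall>n. partially_differentiable p (\<lambda>\<xi>. lt_inv (S \<xi>) n k) \<eta> \<and>
        partially_differentiable p (\<lambda>\<xi>. lt_inv (T \<xi>) n k) \<eta>)"
proof (induction k rule: less_induct)
  case (less k)
  \<comment> \<open>This is the residual of \<open>A\<close> after k elimination steps. Its k-th
    column is that of \<open>lt_inv S\<close> times the pivot \<open>H k\<close>, its k-th row the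
    pivot times the k-th column of \<open>lt_inv T\<close>.\<close>
  have rest: "partially_differentiable p
      (\<lambda>\<xi>. A \<xi> n n' - (\<Sum>i<k. lt_inv (S \<xi>) n i * H \<xi> i * lt_inv (T \<xi>) n' i)) \<eta>" for n n'
    using less by (intro partially_differentiable_diff A partially_differentiable_sum
        partially_differentiable_mult) auto
  have left: "lt_inv (S \<xi>) n k * H \<xi> k =
      A \<xi> n k - (\<Sum>i<k. lt_inv (S \<xi>) n i * H \<xi> i * lt_inv (T \<xi>) k i)" if "\<xi> \<in> U" for \<xi> n
    using unitriangular[OF that] gauss_borel_entry[OF gb[OF that], of n k]
    by (simp add: lower_unitriangular_def flip: lessThan_Suc_atMost)
  have right: "H \<xi> k * lt_inv (T \<xi>) n k =
      A \<xi> k n - (\<Sum>i<k. lt_inv (S \<xi>) k i * H \<xi> i * lt_inv (T \<xi>) n i)" if "\<xi> \<in> U" for \<xi> n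
  proof -
    \<comment> \<open>The entry formula truncates at the column \<open>n\<close>; here the cut is
      needed at the row \<open>k\<close>, again through the common range.\<close>
    have "A \<xi> k n = (\<Sum>i\<le>max n k. lt_inv (S \<xi>) k i * H \<xi> i * lt_inv (T \<xi>) n i)"
      unfolding gauss_borel_entry[OF gb[OF that]] using unitriangular[OF that]
      by (intro sum.mono_neutral_left) (auto simp: lower_unitriangular_def)
    also have "\<dots> = (\<Sum>i\<le>k. lt_inv (S \<xi>) k i * H \<xi> i * lt_inv (T \<xi>) n i)"
      using unitriangular[OF that]
      by (intro sum.mono_neutral_right) (auto simp: lower_unitriangular_def)
    finally show ?thesis
      using unitriangular[OF that]
      by (simp add: lower_unitriangular_def flip: lessThan_Suc_atMost)
  qed
  have "H \<xi> k = A \<xi> k k - (\<Sum>i<k. lt_inv (S \<xi>) k i * H \<xi> i * lt_inv (T \<xi>) k i)" if "\<xi> \<in> U" for \<xi>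
    using left[OF that, of k] unitriangular[OF that] by (simp add: lower_unitriangular_def)
  then have H: "partially_differentiable p (\<lambda>\<xi>. H \<xi> k) \<eta>"
    using rest by (rule partially_differentiable_transfer)
  moreover have "partially_differentiable p (\<lambda>\<xi>. lt_inv (S \<xi>) n k) \<eta>" for n
  proof -
    have "lt_inv (S \<xi>) n k =
        (A \<xi> n k - (\<Sum>i<k. lt_inv (S \<xi>) n i * H \<xi> i * lt_inv (T \<xi>) k i)) / H \<xi> k" if "\<xi> \<in> U" for \<xi>
      using left[OF that, of n] diagonal_nonzero[OF that, of k] by (simp add: eq_divide_eq)
    moreover have "partially_differentiable p
        (\<lambda>\<xi>. (A \<xi> n k - (\<Sum>i<k. lt_inv (S \<xi>) n i * H \<xi> i * lt_inv (T \<xi>) k i)) / H \<xi> k) \<eta>"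
      using rest H diagonal_nonzero[OF \<eta>] by (rule partially_differentiable_divide)
    ultimately show ?thesis
      by (rule partially_differentiable_transfer)
  qed
  moreover have "partially_differentiable p (\<lambda>\<xi>. lt_inv (T \<xi>) n k) \<eta>" for n
  proof -
    have "lt_inv (T \<xi>) n k =
        (A \<xi> k n - (\<Sum>i<k. lt_inv (S \<xi>) k i * H \<xi> i * lt_inv (T \<xi>) n i)) / H \<xi> k" if "\<xi> \<in> U" for \<xi>
      using right[OF that, of n] diagonal_nonzero[OF that, of k]
      by (simp add: eq_divide_eq mult.commute)
    moreover have "partially_differentiable p
        (\<lambda>\<xi>. (A \<xi> k n - (\<Sum>i<k. lt_inv (S \<xi>) k i * H \<xi> i * lt_inv (T \<xi>) n i)) / H \<xi> k) \<eta>"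
      using rest H diagonal_nonzero[OF \<eta>] by (rule partially_differentiable_divide)
    ultimately show ?thesis
      by (rule partially_differentiable_transfer)
  qed
  ultimately show ?case
    by blast
qed

lemma partially_differentiable_diagonal: "partially_differentiable p (\<lambda>\<xi>. H \<xi> n) \<eta>"
  using partially_differentiable_factors by blast

text \<open>Elimination yields the inverse of \<open>S\<close>. Row n of \<open>lt_inv S\<close>
  times \<open>S\<close> being the identity expresses row n of \<open>S\<close> through earlier
  rows.\<close>

lemma partially_differentiable_left_factor: "partially_differentiable p (\<lambda>\<xi>. S \<xi> n k) \<eta>"
proof (induction n rule: less_induct)
  case (less n)
  have "S \<xi> n k = id_matrix n k - (\<Sum>i<n. lt_inv (S \<xi>) n i * S \<xi> i k)" if "\<xi> \<in> U" for \<xi>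
  proof -
    have "lt_mult (lt_inv (S \<xi>)) (S \<xi>) n k = id_matrix n k"
      using is_lt_inverse_lt_inv[OF unitriangular(1)[OF that]] by (simp add: is_lt_inverse_def)
    then show ?thesis
      using unitriangular(3)[OF that]
      by (simp add: lt_mult_def lower_unitriangular_def algebra_simps flip: lessThan_Suc_atMost)
  qed
  moreover have "partially_differentiable p
      (\<lambda>\<xi>. id_matrix n k - (\<Sum>i<n. lt_inv (S \<xi>) n i * S \<xi> i k)) \<eta>"
    using less partially_differentiable_factors
    by (intro partially_differentiable_diff partially_differentiable_const
        partially_differentiable_sum partially_differentiable_mult) auto
  ultimately show ?case
    by (rule partially_differentiable_transfer)
qed

lemma theta_left_factor_diagonal: "theta p (\<lambda>\<xi>. S \<xi> n n) \<eta> = 0"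
  using theta_cong[OF U \<eta>, of "\<lambda>\<xi>. S \<xi> n n" "\<lambda>\<xi>. 1"] unitriangular(1)
  by (simp add: lower_unitriangular_def theta_const)

section \<open>Differentiating the factorization\<close>

context
  assumes theta_A: "\<And>n k. theta p (\<lambda>\<xi>. A \<xi> n k) \<eta> = A \<eta> (Suc n) k"
begin

text \<open>The product rule is applied to an entry of \<open>S\<close> times \<open>A\<close>. On
  and below the diagonal this entry is \<open>H n\<close> or 0 throughout \<open>U\<close>, so no
  derivative of \<open>T\<close> enters.\<close>

lemma theta_diagonal_left_factor:
  assumes "k \<le> n"
  shows "(\<Sum>i\<le>n. theta p (\<lambda>\<xi>. S \<xi> n i) \<eta> * A \<eta> i k) + (\<Sum>i\<le>n. S \<eta> n i * A \<eta> (Suc i) k)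
    = (if k = n then theta p (\<lambda>\<xi>. H \<xi> n) \<eta> else 0)"
proof -
  have "theta p (\<lambda>\<xi>. \<Sum>i\<le>n. S \<xi> n i * A \<xi> i k) \<eta>
      = (\<Sum>i\<le>n. theta p (\<lambda>\<xi>. S \<xi> n i) \<eta> * A \<eta> i k) + (\<Sum>i\<le>n. S \<eta> n i * A \<eta> (Suc i) k)"
    by (simp add: theta_sum theta_mult partially_differentiable_mult A theta_A
        partially_differentiable_left_factor sum.distrib)
  moreover have "theta p (\<lambda>\<xi>. \<Sum>i\<le>n. S \<xi> n i * A \<xi> i k) \<eta>
      = theta p (\<lambda>\<xi>. if k = n then H \<xi> n else 0) \<eta>"
    using assms unitriangular(4)
    by (intro theta_cong[OF U \<eta>])
      (auto simp: gauss_borel_left_mult_entry[OF gb] lower_unitriangular_def)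
  ultimately show ?thesis
    by (auto simp: theta_const)
qed

text \<open>Expanding \<open>A\<close> by columns turns the preceding identity into one for a row
  vector times the transpose of \<open>lt_inv T\<close>, which forward substitution removes. Entries
  below the diagonal govern the subdiagonals of \<open>S\<close>, the diagonal entry governs
  \<open>H\<close>.\<close>

lemma zero_curvature:
  assumes "k \<le> n"
  shows "((\<Sum>i\<le>n. theta p (\<lambda>\<xi>. S \<xi> n i) \<eta> * lt_inv (S \<eta>) i k)
      + (\<Sum>i\<le>n. S \<eta> n i * lt_inv (S \<eta>) (Suc i) k)) * H \<eta> k
    = (if k = n then theta p (\<lambda>\<xi>. H \<xi> n) \<eta> else 0)"
proof -
  define x where "x k = ((\<Sum>i\<le>n. theta p (\<lambda>\<xi>. S \<xi> n i) \<eta> * lt_inv (S \<eta>) i k)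
      + (\<Sum>i\<le>n. S \<eta> n i * lt_inv (S \<eta>) (Suc i) k)) * H \<eta> k" for k
  have "(\<Sum>j\<le>k. x j * lt_inv (T \<eta>) k j)
      = (\<Sum>i\<le>n. theta p (\<lambda>\<xi>. S \<xi> n i) \<eta> * A \<eta> i k) + (\<Sum>i\<le>n. S \<eta> n i * A \<eta> (Suc i) k)" for k
    unfolding gauss_borel_entry[OF gb[OF \<eta>]] sum_distrib_left
    by (subst (1 2) sum.swap)
      (simp add: x_def sum_distrib_right sum.distrib distrib_right mult.assoc)
  then have x: "(\<Sum>j\<le>k. x j * lt_inv (T \<eta>) k j) = (if k = n then theta p (\<lambda>\<xi>. H \<xi> n) \<eta> else 0)"
    if "k \<le> n" for k
    using theta_diagonal_left_factor[OF that] by simp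
  have "(\<Sum>j\<le>k. x j * lt_inv (T \<eta>) k j) = x k"
    using assms by (intro lower_unitriangular_first_nonzero unitriangular \<eta>) (simp add: x)
  then show ?thesis
    using x[OF assms] by (simp add: x_def)
qed

end

end


section \<open>Entries in terms of subdiagonals\<close>

lemma sum_int_atLeast1AtMost:
  "(\<Sum>j=1..int m. F j) = (\<Sum>i<m. F (int i + 1))"
  by (rule sum.reindex_bij_witness[where i = "\<lambda>i. int i + 1" and j = "\<lambda>j. nat (j - 1)"]) auto

lemma sum_lessThan_add:
  fixes g :: "nat \<Rightarrow> 'a::comm_monoid_add"
  shows "(\<Sum>i<n + m. g i) = (\<Sum>i<n. g i) + (\<Sum>i<m. g (n + i))"
  by (induction m) (simp_all add: add.assoc)

text \<open>Only indices \<open>i \<ge> n - 1\<close> contribute. The index \<open>n - 1\<close>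
  meets the diagonal of the inverse and \<open>n + m\<close> the diagonal of \<open>S\<close>. For
  \<open>i = n + j - 1\<close> the shift of the inverse's row to \<open>n + j\<close> pairs its j-th
  subdiagonal with subdiagonal \<open>m - j + 1\<close> of \<open>S\<close>.\<close>

lemma lax_entry:
  assumes S: "lower_unitriangular S"
  shows "(\<Sum>i\<le>n + m. S (n + m) i * lt_inv S (Suc i) n) =
    subdiag S (int m + 1) (int n - 1) + subdiag S (- int m - 1) (int n)
      + (\<Sum>j=1..int m. subdiag S (int m - j + 1) (int n + j - 1) * subdiag S (- j) (int n))"
proof -
  define g where "g i = S (n + m) i * lt_inv S (Suc i) n" for i
  have L: "lower_unitriangular (lt_inv S)"
    using S by (rule lower_unitriangular_lt_inv)
  have "(\<Sum>i\<le>n + m. g i) = (\<Sum>i<n. g i) + (\<Sum>i<m. g (n + i)) + g (n + m)"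
    by (simp add: sum_lessThan_add flip: lessThan_Suc_atMost)
  moreover have "(\<Sum>i<n. g i) = subdiag S (int m + 1) (int n - 1)"
  \<comment> \<open>For \<open>n = 0\<close> the sum is empty, in accordance with the value 0 of
    \<open>subdiag\<close> at index -1.\<close>
  proof (cases n)
    case (Suc n')
    have "(\<Sum>i<n'. g i) = 0"
      using L Suc by (intro sum.neutral) (auto simp: g_def lower_unitriangular_def)
    then show ?thesis
      using L Suc by (simp add: g_def subdiag_def lower_unitriangular_def nat_add_distrib add_ac)
  qed (simp add: subdiag_def)
  moreover have "g (n + m) = subdiag S (- int m - 1) (int n)"
  proof -
    have "nat (int n - (- int m - 1)) = Suc (n + m)"
      by simp
    then show ?thesis
      using S by (simp only: g_def subdiag_def lower_unitriangular_def) simp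
  qed
  moreover have "g (n + i) = subdiag S (int m - (int i + 1) + 1) (int n + (int i + 1) - 1)
      * subdiag S (- (int i + 1)) (int n)" if "i < m" for i
  proof -
    have "nat (int n + (int i + 1) - 1 + (int m - (int i + 1) + 1)) = n + m"
      "nat (int n - - (int i + 1)) = Suc (n + i)" "nat (int n + (int i + 1) - 1) = n + i"
      using that by simp_all
    then show ?thesis
      using that by (simp add: g_def subdiag_def)
  qed
  ultimately show ?thesis
    by (simp add: g_def sum_int_atLeast1AtMost add_ac)
qed

text \<open>In the entry just below the diagonal of \<open>S\<close> times its inverse, only the two
  terms containing a diagonal 1 survive.\<close>

lemma subdiag_minus_one:
  assumes S: "lower_unitriangular S"
  shows "subdiag S (- 1) (int n) = - subdiag S 1 (int n)"
proof -
  have "lt_mult S (lt_inv S) (Suc n) n = 0"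
    using is_lt_inverse_lt_inv[OF S] by (simp add: is_lt_inverse_def id_matrix_def)
  moreover have "(\<Sum>i<n. S (Suc n) i * lt_inv S i n) = 0"
    using lower_unitriangular_lt_inv[OF S]
    by (intro sum.neutral) (auto simp: lower_unitriangular_def)
  ultimately show ?thesis
    using S lower_unitriangular_lt_inv[OF S]
    by (simp add: lt_mult_def subdiag_def lower_unitriangular_def nat_add_distrib
        add_eq_0_iff flip: lessThan_Suc_atMost)
qed

text \<open>Terms with \<open>i < n\<close> vanish by triangularity of the inverse and
  \<open>i = n + m\<close> by \<open>diag\<close>. The index \<open>i = n\<close> gives the isolated
  summand, and \<open>i = n + j\<close> the j-th term of the sum.\<close>

lemma theta_row_entry:
  assumes L: "lower_unitriangular (lt_inv (S \<eta>))" and m: "m \<ge> 1"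
    and diag: "theta p (\<lambda>\<xi>. S \<xi> (n + m) (n + m)) \<eta> = 0"
  shows "(\<Sum>i\<le>n + m. theta p (\<lambda>\<xi>. S \<xi> (n + m) i) \<eta> * lt_inv (S \<eta>) i n) =
    theta p (\<lambda>\<xi>. subdiag (S \<xi>) (int m) (int n)) \<eta>
      + (\<Sum>j=1..int m - 1. theta p (\<lambda>\<xi>. subdiag (S \<xi>) (int m - j) (int n + j)) \<eta>
          * subdiag (S \<eta>) (- j) (int n))"
proof -
  define g where "g i = theta p (\<lambda>\<xi>. S \<xi> (n + m) i) \<eta> * lt_inv (S \<eta>) i n" for i
  obtain m' where m': "m = Suc m'"
    using m by (cases m) auto
  have "(\<Sum>i\<le>n + m. g i) = (\<Sum>i<n + m. g i)"
    using diag by (simp add: g_def flip: lessThan_Suc_atMost)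
  also have "\<dots> = (\<Sum>i<n. g i) + (g n + (\<Sum>i<m'. g (n + Suc i)))"
    unfolding sum_lessThan_add m' sum.lessThan_Suc_shift by simp
  also have "(\<Sum>i<n. g i) = 0"
    using L by (intro sum.neutral) (auto simp: g_def lower_unitriangular_def)
  also have "g n = theta p (\<lambda>\<xi>. subdiag (S \<xi>) (int m) (int n)) \<eta>"
    using L m by (simp add: g_def subdiag_def lower_unitriangular_def nat_add_distrib)
  also have "(\<Sum>i<m'. g (n + Suc i)) =
      (\<Sum>j=1..int m'. theta p (\<lambda>\<xi>. subdiag (S \<xi>) (int m - j) (int n + j)) \<eta>
          * subdiag (S \<eta>) (- j) (int n))"
    unfolding sum_int_atLeast1AtMost
  proof (intro sum.cong refl)
    fix i assume "i \<in> {..<m'}"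
    then have "nat (int n + (int i + 1) + (int m - (int i + 1))) = n + m"
      "nat (int n - - (int i + 1)) = n + Suc i" "nat (int n + (int i + 1)) = n + Suc i"
      by (simp_all add: m')
    then show "g (n + Suc i) = theta p (\<lambda>\<xi>. subdiag (S \<xi>) (int m - (int i + 1)) (int n + (int i + 1))) \<eta>
        * subdiag (S \<eta>) (- (int i + 1)) (int n)"
      using \<open>i \<in> {..<m'}\<close> by (simp add: g_def subdiag_def m')
  qed
  finally show ?thesis
    by (simp add: g_def m')
qed


section \<open>The system\<close>

theorem theorem3p9:
  fixes p :: nat
    and b :: "nat \<Rightarrow> complex list" and c :: "complex list"
    and U :: "(nat \<Rightarrow> complex) set"
    and S T :: "(nat \<Rightarrow> complex) \<Rightarrow> nat \<Rightarrow> nat \<Rightarrow> complex"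
    and H :: "(nat \<Rightarrow> complex) \<Rightarrow> nat \<Rightarrow> complex"
    and q :: "nat \<Rightarrow> (nat \<Rightarrow> complex) \<Rightarrow> complex"
    and f :: "int \<Rightarrow> int \<Rightarrow> (nat \<Rightarrow> complex) \<Rightarrow> complex"
    and \<eta> :: "nat \<Rightarrow> complex"
  assumes "p \<ge> 1"
    and "\<forall>x\<in>set c. x \<notin> \<int>\<^sub>\<le>\<^sub>0"
    and "openin (eta_space p) U"
    and "\<forall>\<xi>\<in>U. \<forall>a\<in>{1..p}. \<forall>m::nat. summable (\<lambda>k. of_nat k ^ m * weight b c \<xi> a k)"
    and "\<forall>\<xi>\<in>U. gauss_borel (moment_matrix p b c \<xi>) (S \<xi>) (H \<xi>) (T \<xi>)"
    and "\<eta> \<in> U"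
    and "\<forall>n. local_log_branch p (\<lambda>\<xi>. H \<xi> n) (q n) \<eta>"
    and "\<forall>m n. f m n = (\<lambda>\<xi>. subdiag (S \<xi>) m n)"
  shows
    "(\<forall>n. partially_differentiable p (q n) \<eta>) \<and>
     (\<forall>m\<in>{1..int p}. \<forall>n::nat. partially_differentiable p (f m (int n)) \<eta>) \<and>
     (\<forall>n::nat. theta p (q n) \<eta> = f 1 (int n - 1) \<eta> - f 1 (int n) \<eta>) \<and>
     (\<forall>n::nat. \<forall>m\<in>{1..int p - 1}.
        f (m + 1) (int n - 1) \<eta> + f (- m - 1) (int n) \<eta>
          + (\<Sum>j=1..m. f (m - j + 1) (int n + j - 1) \<eta> * f (- j) (int n) \<eta>)
        = - (theta p (f m (int n)) \<eta>
             + (\<Sum>j=1..m - 1. theta p (f (m - j) (int n + j)) \<eta> * f (- j) (int n) \<eta>))) \<and>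
     (\<forall>n::nat. exp (q (n + p) \<eta> - q n \<eta>)
        = - (theta p (f (int p) (int n)) \<eta>
             + (\<Sum>j=1..int p - 1. theta p (f (int p - j) (int n + j)) \<eta> * f (- j) (int n) \<eta>)))"
proof -
  note p = assms(1) and U = assms(3) and summable = assms(4) and \<eta> = assms(6) and q = assms(7)
  have gb: "gauss_borel (moment_matrix p b c \<xi>) (S \<xi>) (H \<xi>) (T \<xi>)" if "\<xi> \<in> U" for \<xi>
    using assms(5) that by blast
  have f: "f m n = (\<lambda>\<xi>. subdiag (S \<xi>) m n)" for m n
    using assms(8) by blast
  have col: "i mod p + 1 \<in> {1..p}" for i
    using p by (simp add: Suc_leI)
  have A: "partially_differentiable p (\<lambda>\<xi>. moment_matrix p b c \<xi> n k) \<eta>"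
    and theta_A: "theta p (\<lambda>\<xi>. moment_matrix p b c \<xi> n k) \<eta> = moment_matrix p b c \<eta> (Suc n) k" for n k
    unfolding moment_matrix_def
    using partially_differentiable_moment[OF U \<eta> col] theta_moment[OF U \<eta> col] summable col
    by simp_all
  \<comment> \<open>Moving by \<open>p\<close> columns keeps the weight and raises the order by one,
    exactly as moving down one row does.\<close>
  have shift: "moment_matrix p b c \<eta> (Suc n) k = moment_matrix p b c \<eta> n (k + p)" for n k
    using p by (simp add: moment_matrix_def)
  note unitriangular = gauss_borel_unitriangular[OF gb[OF \<eta>]]
  have H_nonzero: "H \<eta> n \<noteq> 0" for n
    using gb[OF \<eta>] by (simp add: gauss_borel_def)
  note H_diff = partially_differentiable_diagonal[OF U \<eta> gb A]
  note S_diff = partially_differentiable_left_factor[OF U \<eta> gb A]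
  note zero_curvature = zero_curvature[OF U \<eta> gb A theta_A]
  have exp_q: "exp (q n \<eta>) = H \<eta> n" for n
    using q unfolding local_log_branch_def by blast
  \<comment> \<open>Since \<open>m \<ge> 1\<close>, column \<open>n\<close> lies strictly below the
    diagonal in row \<open>n + m\<close>; the zero-curvature entry is 0 there and
    \<open>H \<eta> n\<close> cancels.\<close>
  have lower: "(\<Sum>i\<le>n + m. S \<eta> (n + m) i * lt_inv (S \<eta>) (Suc i) n)
      = - (theta p (f (int m) (int n)) \<eta>
        + (\<Sum>j=1..int m - 1. theta p (f (int m - j) (int n + j)) \<eta> * f (- j) (int n) \<eta>))"
    if "m \<ge> 1" for n m
    using zero_curvature[of n "n + m"] H_nonzero[of n] that
      theta_row_entry[OF unitriangular(3) that theta_left_factor_diagonal[OF U \<eta> gb A]]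
    by (simp add: f add_eq_0_iff)
  show ?thesis
  proof (intro conjI allI ballI)
    show "partially_differentiable p (q n) \<eta>" for n
      using q H_diff by (blast intro: partially_differentiable_log_branch)
    show "partially_differentiable p (f m (int n)) \<eta>" if "m \<in> {1..int p}" for m n
      using that S_diff by (simp add: f subdiag_def)
    show "theta p (q n) \<eta> = f 1 (int n - 1) \<eta> - f 1 (int n) \<eta>" for n
    proof -
      \<comment> \<open>On the diagonal only the shift term remains, and by \<open>lax_entry\<close>
        with \<open>m = 0\<close> it is a difference of neighbouring values of
        \<open>f 1\<close>.\<close>
      have "(\<Sum>i\<le>n. theta p (\<lambda>\<xi>. S \<xi> n i) \<eta> * lt_inv (S \<eta>) i n) = 0"
        using unitriangular(3) theta_left_factor_diagonal[OF U \<eta> gb A]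
        by (intro sum.neutral) (auto simp: lower_unitriangular_def le_less)
      then have "(f 1 (int n - 1) \<eta> - f 1 (int n) \<eta>) * H \<eta> n = theta p (\<lambda>\<xi>. H \<xi> n) \<eta>"
        using zero_curvature[of n n] lax_entry[OF unitriangular(1), of n 0]
          subdiag_minus_one[OF unitriangular(1), of n]
        by (simp add: f)
      also have "\<dots> = H \<eta> n * theta p (q n) \<eta>"
        using q H_diff by (blast intro: theta_log_branch)
      finally show ?thesis
        using H_nonzero[of n] by simp
    qed
    show "f (m + 1) (int n - 1) \<eta> + f (- m - 1) (int n) \<eta>
          + (\<Sum>j=1..m. f (m - j + 1) (int n + j - 1) \<eta> * f (- j) (int n) \<eta>)
        = - (theta p (f m (int n)) \<eta>
             + (\<Sum>j=1..m - 1. theta p (f (m - j) (int n + j)) \<eta> * f (- j) (int n) \<eta>))"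
      if "m \<in> {1..int p - 1}" for n m
    proof -
      obtain m' where "m = int m'" "m' \<ge> 1"
        using \<open>m \<in> {1..int p - 1}\<close> by (cases m rule: int_cases2) auto
      then show ?thesis
        \<comment> \<open>The equation compares two evaluations of the same entry of
          \<open>S\<close> times shift times inverse: by subdiagonals and by
          \<open>theta\<close>.\<close>
        using lower[of m' n] lax_entry[OF unitriangular(1), of n m'] by (simp add: f)
    qed
    show "exp (q (n + p) \<eta> - q n \<eta>)
        = - (theta p (f (int p) (int n)) \<eta>
             + (\<Sum>j=1..int p - 1. theta p (f (int p - j) (int n + j)) \<eta> * f (- j) (int n) \<eta>))" for n
      \<comment> \<open>On the p-th subdiagonal the same entry is \<open>H (n + p) / H n\<close>;
        exponentiating removes the choice of branches.\<close>
      using lower[OF p, of n] lax_lowest_diagonal[OF gb[OF \<eta>] shift, of n] H_nonzero[of n]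
      by (simp add: exp_diff exp_q divide_eq_eq)
  qed
qed

end
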